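(* Let $n\ge2$ be an integer and let $\boldsymbol{X}=(X_1,\dots,X_n)$ be an exchangeable random vector in $\mathbb{R}^n$ whose entries have zero mean, unit variance and finite third moment. Then $$\mathrm{osc}(\boldsymbol{X})\le\sqrt{\big|\mathbb{E}[X_1^2X_2^2]-1\big|}+\frac{4\,\mathbb{E}\big[|X_1|^3\big]}{\sqrt[4]n}.$$
   Context: A random vector is exchangeable if its distribution is invariant under permutations of the coordinates. Here $\mathrm{osc}(\boldsymbol{X}):=\mathbb{E}\big|\frac1n\sum_{j=1}^nX_j^2-1\big|$ (the oscillation of $\boldsymbol{X}$, as $\mathbb{E}[X_1^2]=1$). The expectation $\mathbb{E}[X_1^2X_2^2]\in[0,\infty]$ is that of a nonnegative random variable (the bound is trivial if it is $+\infty$). *)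

theory Defs
  imports "HOL-Probability.Probability"
begin

text \<open>
  A random vector in \<open>\<real>\<^sup>n\<close> on a probability space \<open>M\<close> is given by its coordinates
  \<open>X i\<close> for \<open>i \<in> {1..n}\<close>; values of \<open>X\<close> at other indices play no role.
\<close>

definition joint_distr :: "'a measure \<Rightarrow> nat \<Rightarrow> (nat \<Rightarrow> 'a \<Rightarrow> real) \<Rightarrow> (nat \<Rightarrow> real) measure" where
  "joint_distr M n X =
     distr M (Pi\<^sub>M {1..n} (\<lambda>_. borel)) (\<lambda>\<omega>. \<lambda>i\<in>{1..n}. X i \<omega>)"

definition exchangeable :: "'a measure \<Rightarrow> nat \<Rightarrow> (nat \<Rightarrow> 'a \<Rightarrow> real) \<Rightarrow> bool" where
  "exchangeable M n X \<longleftrightarrow>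
     (\<forall>\<pi>. \<pi> permutes {1..n} \<longrightarrow> joint_distr M n (\<lambda>i. X (\<pi> i)) = joint_distr M n X)"

definition osc :: "'a measure \<Rightarrow> nat \<Rightarrow> (nat \<Rightarrow> 'a \<Rightarrow> real) \<Rightarrow> real" where
  "osc M n X = (\<integral>\<omega>. \<bar>(1 / real n) * (\<Sum>j=1..n. (X j \<omega>)\<^sup>2) - 1\<bar> \<partial>M)"

text \<open>
  The square root on the extended half-line, with \<open>ereal_sqrt \<infinity> = \<infinity>\<close>. It is only
  applied to nonnegative arguments; the value at \<open>-\<infinity>\<close> merely totalises the definition.
\<close>

fun ereal_sqrt :: "ereal \<Rightarrow> ereal" where
  "ereal_sqrt (ereal r) = ereal (sqrt r)"
| "ereal_sqrt PInfty = PInfty"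
| "ereal_sqrt MInfty = MInfty"

end

theory Submission
  imports Defs
begin

text \<open>
  Truncate the squares: let \<open>Z\<^sub>i = X\<^sub>i\<^sup>2\<close> where \<open>\<bar>X\<^sub>i\<bar> \<le> T\<close> and \<open>Z\<^sub>i = 0\<close> elsewhere, with
  \<open>T = \<surd>n\<close>, and let \<open>m = E\<bar>X\<^sub>1\<bar>\<^sup>3\<close>. The discarded part has mean at most \<open>m / T\<close>, and
  \<open>E Z\<^sub>i\<^sup>2 \<le> m T\<close>, while \<open>E Z\<^sub>i Z\<^sub>j \<le> E X\<^sub>1\<^sup>2 X\<^sub>2\<^sup>2\<close> for \<open>i \<noteq> j\<close> by exchangeability. Expanding the
  square bounds the mean square deviation of the average of the \<open>Z\<^sub>i\<close> from \<open>1\<close> by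
  \<open>\<bar>E X\<^sub>1\<^sup>2 X\<^sub>2\<^sup>2 - 1\<bar> + 3 m / T\<close>, and the Cauchy--Schwarz inequality concludes, using \<open>m \<ge> 1\<close>,
  which holds because the variance is \<open>1\<close>.
\<close>

text \<open>Transports equality of the joint laws to integrals. With nonnegative integrals no
  integrability of \<open>f\<close> is required, so possibly infinite product moments are
  covered.\<close>

lemma exchangeable_nn_integral:
  assumes "exchangeable M n X" "\<pi> permutes {1..n}"
    and X: "\<And>i. i \<in> {1..n} \<Longrightarrow> X i \<in> borel_measurable M"
    and f: "f \<in> borel_measurable (Pi\<^sub>M {1..n} (\<lambda>_. borel :: real measure))"
  shows "(\<integral>\<^sup>+\<omega>. f (\<lambda>i\<in>{1..n}. X (\<pi> i) \<omega>) \<partial>M) = (\<integral>\<^sup>+\<omega>. f (\<lambda>i\<in>{1..n}. X i \<omega>) \<partial>M)"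
proof -
  have *: "(\<integral>\<^sup>+x. f x \<partial>joint_distr M n Y) = (\<integral>\<^sup>+\<omega>. f (\<lambda>i\<in>{1..n}. Y i \<omega>) \<partial>M)"
    if "\<And>i. i \<in> {1..n} \<Longrightarrow> Y i \<in> borel_measurable M" for Y
    unfolding joint_distr_def
    by (rule nn_integral_distr) (use that f in \<open>auto intro: measurable_restrict\<close>)
  have "X (\<pi> i) \<in> borel_measurable M" if "i \<in> {1..n}" for i
    using X that permutes_in_image[OF assms(2)] by blast
  then show ?thesis
    using *[of "\<lambda>i. X (\<pi> i)"] *[of X] X assms(1,2) by (simp add: exchangeable_def)
qed

lemma permutes_pairE:
  assumes "i \<in> S" "j \<in> S" "a \<in> S" "b \<in> S" "i \<noteq> j" "a \<noteq> b"
  obtains \<pi> where "\<pi> permutes S" "\<pi> a = i" "\<pi> b = j"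
proof
  \<comment> \<open>\<open>?k\<close> is the preimage of \<open>j\<close> under the outer
    transposition. The inner one sends \<open>b\<close> to \<open>?k\<close> and fixes
    \<open>a\<close>, since \<open>a\<close> differs from \<open>b\<close> and from
    \<open>?k\<close>.\<close>
  let ?k = "Transposition.transpose a i j"
  have "?k \<in> S" "?k \<noteq> a" using assms by (auto simp: Transposition.transpose_def)
  then show "Transposition.transpose a i \<circ> Transposition.transpose b ?k permutes S"
    using assms by (intro permutes_compose permutes_swap_id)
  show "(Transposition.transpose a i \<circ> Transposition.transpose b ?k) a = i"
    using assms \<open>?k \<noteq> a\<close> by simp
  show "(Transposition.transpose a i \<circ> Transposition.transpose b ?k) b = j" by simp
qed

lemma exchangeable_nn_integral_pair:
  assumes "exchangeable M n X"
    and X: "\<And>i. i \<in> {1..n} \<Longrightarrow> X i \<in> borel_measurable M"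
    and g: "case_prod g \<in> borel_measurable (borel \<Otimes>\<^sub>M borel)"
    and ij: "i \<in> {1..n}" "j \<in> {1..n}" "i \<noteq> j"
  shows "(\<integral>\<^sup>+\<omega>. g (X i \<omega>) (X j \<omega>) \<partial>M) = (\<integral>\<^sup>+\<omega>. g (X 1 \<omega>) (X 2 \<omega>) \<partial>M)"
proof -
  have 12: "1 \<in> {1..n}" "2 \<in> {1..n}" using ij by auto
  obtain \<pi> where \<pi>: "\<pi> permutes {1..n}" "\<pi> 1 = i" "\<pi> 2 = j"
    by (rule permutes_pairE[OF ij(1,2) 12 ij(3)]) auto
  have "(\<lambda>x. case_prod g (x 1, x 2)) \<in> borel_measurable (Pi\<^sub>M {1..n} (\<lambda>_. borel :: real measure))"
    using 12 by (intro measurable_compose[OF _ g] measurable_Pair measurable_component_singleton)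
  from exchangeable_nn_integral[OF assms(1) \<pi>(1) X this] show ?thesis
    using 12 \<pi> by simp
qed

text \<open>Cauchy-Schwarz against the constant 1, read off from the nonnegativity of the variance
  of |V|.\<close>

lemma (in prob_space) expectation_abs_le_sqrt:
  fixes V :: "'a \<Rightarrow> real"
  assumes "integrable M V" "integrable M (\<lambda>x. (V x)\<^sup>2)"
  shows "expectation (\<lambda>x. \<bar>V x\<bar>) \<le> sqrt (expectation (\<lambda>x. (V x)\<^sup>2))"
proof -
  have "0 \<le> variance (\<lambda>x. \<bar>V x\<bar>)" by (rule variance_positive)
  also have "\<dots> = expectation (\<lambda>x. (V x)\<^sup>2) - (expectation (\<lambda>x. \<bar>V x\<bar>))\<^sup>2"
    using assms by (subst variance_eq) auto
  finally show ?thesis by (intro real_le_rsqrt) simp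
qed

definition trunc_sq :: "real \<Rightarrow> real \<Rightarrow> real" where
  "trunc_sq T x = (if \<bar>x\<bar> \<le> T then x\<^sup>2 else 0)"

lemma trunc_sq_measurable [measurable]: "trunc_sq T \<in> borel_measurable borel"
  unfolding trunc_sq_def by measurable

lemma trunc_sq_nonneg: "0 \<le> trunc_sq T x"
  by (simp add: trunc_sq_def)

lemma trunc_sq_le_square: "trunc_sq T x \<le> x\<^sup>2"
  by (simp add: trunc_sq_def)

lemma trunc_sq_le: "trunc_sq T x \<le> T\<^sup>2"
  by (auto simp: trunc_sq_def abs_le_square_iff[symmetric])

text \<open>The left side is nonzero only where |x| > T, and there the extra factor |x| / T exceeds
  1.\<close>

lemma square_minus_trunc_sq_le:
  assumes "0 < T" shows "x\<^sup>2 - trunc_sq T x \<le> \<bar>x\<bar> ^ 3 / T"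
proof (cases "\<bar>x\<bar> \<le> T")
  case False
  then have "T * x\<^sup>2 \<le> \<bar>x\<bar> * x\<^sup>2" by (intro mult_right_mono) auto
  also have "\<dots> = \<bar>x\<bar> ^ 3" by (simp add: power2_eq_square power3_eq_cube)
  finally show ?thesis using False assms by (simp add: trunc_sq_def field_simps)
qed (use assms in \<open>simp add: trunc_sq_def\<close>)

text \<open>Where |x| \<le> T, one of the four factors |x| is replaced by T; a third moment thus
  controls a truncated fourth moment.\<close>

lemma trunc_sq_squared_le:
  assumes "0 \<le> T" shows "trunc_sq T x * trunc_sq T x \<le> T * \<bar>x\<bar> ^ 3"
proof (cases "\<bar>x\<bar> \<le> T")
  case True
  have "x\<^sup>2 * x\<^sup>2 = \<bar>x\<bar> * \<bar>x\<bar> ^ 3" by (simp add: power2_eq_square power3_eq_cube)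
  also have "\<dots> \<le> T * \<bar>x\<bar> ^ 3" using True by (intro mult_right_mono) auto
  finally show ?thesis using True by (simp add: trunc_sq_def)
qed (use assms in \<open>simp add: trunc_sq_def\<close>)

text \<open>Fourth moments of the \<open>X i\<close> may be infinite, so the deviation is split as
  \<open>V + D\<close>: \<open>V\<close> comes from the bounded \<open>Z i\<close> and has a second
  moment to expand, while \<open>D\<close> is the discarded part, controlled in mean. The level
  \<open>T\<close> stays free here.\<close>

lemma (in prob_space) osc_le_truncated:
  assumes n: "n > 0" and T: "T > 0"
    and X [measurable]: "\<And>i. i \<in> {1..n} \<Longrightarrow> X i \<in> borel_measurable M"
    and sq: "\<And>i. i \<in> {1..n} \<Longrightarrow> expectation (\<lambda>\<omega>. (X i \<omega>)\<^sup>2) = 1"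
    and i3: "\<And>i. i \<in> {1..n} \<Longrightarrow> integrable M (\<lambda>\<omega>. \<bar>X i \<omega>\<bar> ^ 3)"
    and m: "\<And>i. i \<in> {1..n} \<Longrightarrow> expectation (\<lambda>\<omega>. \<bar>X i \<omega>\<bar> ^ 3) \<le> m"
    and e: "\<And>i j. i \<in> {1..n} \<Longrightarrow> j \<in> {1..n} \<Longrightarrow> i \<noteq> j \<Longrightarrow>
              (\<integral>\<^sup>+\<omega>. ennreal ((X i \<omega>)\<^sup>2 * (X j \<omega>)\<^sup>2) \<partial>M) \<le> ennreal e"
    and e0: "0 \<le> e"
  shows "osc M n X \<le> sqrt (\<bar>e - 1\<bar> + T * m / n + 2 * m / T) + m / T"
proof -
  define Z where "Z i \<omega> = trunc_sq T (X i \<omega>)" for i \<omega>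
  have Zm [measurable]: "Z i \<in> borel_measurable M" if "i \<in> {1..n}" for i
    unfolding Z_def using X[OF that] by measurable
  \<comment> \<open>The integral of a non-integrable function is 0 by convention, so the value 1
    forces integrability.\<close>
  have isq: "integrable M (\<lambda>\<omega>. (X i \<omega>)\<^sup>2)" if "i \<in> {1..n}" for i
    using sq[OF that] not_integrable_integral_eq by fastforce
  have Zbd: "\<bar>Z i \<omega>\<bar> \<le> T\<^sup>2" for i \<omega>
    using trunc_sq_le trunc_sq_nonneg by (simp add: Z_def)
  have Z0: "0 \<le> Z i \<omega>"
    and Zsq: "Z i \<omega> \<le> (X i \<omega>)\<^sup>2"
    and Ztail: "(X i \<omega>)\<^sup>2 - Z i \<omega> \<le> \<bar>X i \<omega>\<bar> ^ 3 / T"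
    and Zsquared: "Z i \<omega> * Z i \<omega> \<le> T * \<bar>X i \<omega>\<bar> ^ 3" for i \<omega>
    using T by (simp_all add: Z_def trunc_sq_nonneg trunc_sq_le_square square_minus_trunc_sq_le
        trunc_sq_squared_le)
  have iZ: "integrable M (Z i)" if "i \<in> {1..n}" for i
    using that Zbd by (intro integrable_const_bound[where B="T\<^sup>2"]) auto
  have iZZ: "integrable M (\<lambda>\<omega>. Z i \<omega> * Z j \<omega>)" if "i \<in> {1..n}" "j \<in> {1..n}" for i j
  proof (rule integrable_const_bound[where B="T\<^sup>2 * T\<^sup>2"])
    show "AE \<omega> in M. norm (Z i \<omega> * Z j \<omega>) \<le> T\<^sup>2 * T\<^sup>2"
      unfolding real_norm_def abs_mult by (intro AE_I2 mult_mono Zbd) auto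
  qed (use that in measurable)
  have EZ: "1 - m / T \<le> expectation (Z i)" if "i \<in> {1..n}" for i
  proof -
    have "1 - expectation (Z i) = expectation (\<lambda>\<omega>. (X i \<omega>)\<^sup>2 - Z i \<omega>)"
      using isq iZ sq that by simp
    also have "\<dots> \<le> expectation (\<lambda>\<omega>. \<bar>X i \<omega>\<bar> ^ 3 / T)"
      using isq iZ i3 that T
      by (intro integral_mono) (auto simp: Ztail)
    also have "\<dots> \<le> m / T"
      using m that T by (simp add: divide_right_mono)
    finally show ?thesis by simp
  qed
  have EZZ: "expectation (\<lambda>\<omega>. Z i \<omega> * Z j \<omega>) \<le> (if i = j then T * m else e)"
    if ij: "i \<in> {1..n}" "j \<in> {1..n}" for i j
  proof (cases "i = j")
    case True
    have "expectation (\<lambda>\<omega>. Z i \<omega> * Z i \<omega>) \<le> expectation (\<lambda>\<omega>. T * \<bar>X i \<omega>\<bar> ^ 3)"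
      using iZZ i3 ij T
      by (intro integral_mono) (auto simp: Zsquared)
    also have "\<dots> \<le> T * m" using m ij T by simp
    finally show ?thesis using True by simp
  next
    case False
    have "ennreal (expectation (\<lambda>\<omega>. Z i \<omega> * Z j \<omega>)) = (\<integral>\<^sup>+\<omega>. ennreal (Z i \<omega> * Z j \<omega>) \<partial>M)"
      using iZZ ij by (intro nn_integral_eq_integral[symmetric]) (auto simp: Z0)
    also have "\<dots> \<le> (\<integral>\<^sup>+\<omega>. ennreal ((X i \<omega>)\<^sup>2 * (X j \<omega>)\<^sup>2) \<partial>M)"
      by (intro nn_integral_mono ennreal_leI mult_mono)
         (auto simp: Z0 Zsq)
    also have "\<dots> \<le> ennreal e" using e ij False by simp
    \<comment> \<open>\<open>ennreal\<close> collapses negative reals to 0; \<open>e0\<close> makes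
      the comparison descend to the reals.\<close>
    finally show ?thesis using False e0 by simp
  qed
  \<comment> \<open>The deviation is taken from 1 rather than from the mean of the average, so
    one-sided moment bounds suffice.\<close>
  define V where "V \<omega> = (1 / real n) * (\<Sum>j=1..n. Z j \<omega>) - 1" for \<omega>
  have iV: "integrable M V"
    unfolding V_def using iZ by (intro Bochner_Integration.integrable_diff integrable_mult_right
      Bochner_Integration.integrable_sum) auto
  have V2: "(V \<omega>)\<^sup>2 = (1 / (real n)\<^sup>2) * (\<Sum>i=1..n. \<Sum>j=1..n. Z i \<omega> * Z j \<omega>)
      - (2 / real n) * (\<Sum>j=1..n. Z j \<omega>) + 1" for \<omega>
    unfolding V_def sum_product[symmetric] by (simp add: power2_eq_square algebra_simps)
  have iS1: "integrable M (\<lambda>\<omega>. \<Sum>j=1..n. Z j \<omega>)"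
    and iS2: "integrable M (\<lambda>\<omega>. \<Sum>i=1..n. \<Sum>j=1..n. Z i \<omega> * Z j \<omega>)"
    using iZ iZZ by (auto intro!: Bochner_Integration.integrable_sum)
  have ES1: "expectation (\<lambda>\<omega>. \<Sum>j=1..n. Z j \<omega>) = (\<Sum>j=1..n. expectation (Z j))"
    using iZ by (intro Bochner_Integration.integral_sum) auto
  have ES2: "expectation (\<lambda>\<omega>. \<Sum>i=1..n. \<Sum>j=1..n. Z i \<omega> * Z j \<omega>)
      = (\<Sum>i=1..n. \<Sum>j=1..n. expectation (\<lambda>\<omega>. Z i \<omega> * Z j \<omega>))"
    using iZZ by (subst Bochner_Integration.integral_sum)
      (auto intro!: sum.cong Bochner_Integration.integral_sum)
  have iV2: "integrable M (\<lambda>\<omega>. (V \<omega>)\<^sup>2)"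
    unfolding V2 using iS1 iS2 by (intro Bochner_Integration.integrable_diff
      Bochner_Integration.integrable_add integrable_mult_right integrable_const)
  have "expectation (\<lambda>\<omega>. (V \<omega>)\<^sup>2) = (1 / (real n)\<^sup>2) * (\<Sum>i=1..n. \<Sum>j=1..n. expectation (\<lambda>\<omega>. Z i \<omega> * Z j \<omega>))
      - (2 / real n) * (\<Sum>j=1..n. expectation (Z j)) + 1"
    unfolding V2 ES1[symmetric] ES2[symmetric] using iS1 iS2 by (simp add: prob_space)
  \<comment> \<open>The linear term has a negative sign, so the lower bound \<open>EZ\<close> serves
    there, next to the upper bounds \<open>EZZ\<close>.\<close>
  also have "\<dots> \<le> (1 / (real n)\<^sup>2) * (\<Sum>i=1..n. \<Sum>j=1..n. if i = j then T * m else e)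
      - (2 / real n) * (\<Sum>j=1..n. 1 - m / T) + 1"
    by (intro add_mono diff_mono mult_left_mono sum_mono EZZ EZ) auto
  \<comment> \<open>Each row has one diagonal entry and n - 1 others.\<close>
  also have "(\<Sum>i=1..n. \<Sum>j=1..n. if i = j then T * m else e) = (\<Sum>i=1..n. T * m + (real n - 1) * e)"
    using n by (intro sum.cong) (auto simp: sum.If_cases Diff_eq[symmetric])
  also have "(1 / (real n)\<^sup>2) * (\<Sum>i=1..n. T * m + (real n - 1) * e) - (2 / real n) * (\<Sum>j=1..n. 1 - m / T) + 1
      = T * m / n + (e - e / n) - 1 + 2 * m / T"
    using n T by (simp add: field_simps power2_eq_square)
  also have "\<dots> \<le> \<bar>e - 1\<bar> + T * m / n + 2 * m / T"
    using divide_nonneg_nonneg[OF e0, of n] by linarith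
  finally have EV2: "expectation (\<lambda>\<omega>. (V \<omega>)\<^sup>2) \<le> \<bar>e - 1\<bar> + T * m / n + 2 * m / T" .
  define D where "D \<omega> = (1 / real n) * (\<Sum>j=1..n. (X j \<omega>)\<^sup>2 - Z j \<omega>)" for \<omega>
  have iD: "integrable M D"
    unfolding D_def using iZ isq by (intro Bochner_Integration.integrable_diff integrable_mult_right
      Bochner_Integration.integrable_sum) auto
  have D0: "0 \<le> D \<omega>" for \<omega>
    unfolding D_def by (intro mult_nonneg_nonneg sum_nonneg) (auto simp: Zsq)
  have VD: "(1 / real n) * (\<Sum>j=1..n. (X j \<omega>)\<^sup>2) - 1 = V \<omega> + D \<omega>" for \<omega>
    by (simp add: V_def D_def sum_subtractf algebra_simps)
  \<comment> \<open>As \<open>D\<close> is nonnegative, it leaves the absolute value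
    unchanged.\<close>
  have "osc M n X \<le> expectation (\<lambda>\<omega>. \<bar>V \<omega>\<bar> + D \<omega>)"
    unfolding osc_def VD
  proof (rule integral_mono)
    show "\<bar>V \<omega> + D \<omega>\<bar> \<le> \<bar>V \<omega>\<bar> + D \<omega>" for \<omega> using D0[of \<omega>] by arith
  qed (use iV iD in auto)
  also have "\<dots> = expectation (\<lambda>\<omega>. \<bar>V \<omega>\<bar>) + expectation D"
    using iV iD by simp
  also have "expectation D = (1 / real n) * (\<Sum>j=1..n. 1 - expectation (Z j))"
    unfolding D_def using iZ isq sq by simp
  also have "\<dots> \<le> (1 / real n) * (\<Sum>j=1..n. m / T)"
  proof (intro mult_left_mono sum_mono)
    show "1 - expectation (Z j) \<le> m / T" if "j \<in> {1..n}" for j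
      using EZ[OF that] by simp
  qed simp
  also have "\<dots> = m / T" using n by simp
  also have "expectation (\<lambda>\<omega>. \<bar>V \<omega>\<bar>) \<le> sqrt (\<bar>e - 1\<bar> + T * m / n + 2 * m / T)"
    using expectation_abs_le_sqrt[OF iV iV2] EV2 real_sqrt_le_mono order_trans by blast
  finally show ?thesis by simp
qed

theorem proposition12p3:
  fixes M :: "'a measure" and X :: "nat \<Rightarrow> 'a \<Rightarrow> real" and n :: nat
  assumes "prob_space M"
    and "n \<ge> 2"
    and "\<And>i. i \<in> {1..n} \<Longrightarrow> X i \<in> borel_measurable M"
    and "exchangeable M n X"
    and "\<And>i. i \<in> {1..n} \<Longrightarrow> prob_space.expectation M (X i) = 0"
    and "\<And>i. i \<in> {1..n} \<Longrightarrow> prob_space.variance M (X i) = 1"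
    and "\<And>i. i \<in> {1..n} \<Longrightarrow> integrable M (\<lambda>\<omega>. \<bar>X i \<omega>\<bar> ^ 3)"
  shows "ereal (osc M n X)
    \<le> ereal_sqrt \<bar>enn2ereal (\<integral>\<^sup>+ \<omega>. ennreal ((X 1 \<omega>)\<^sup>2 * (X 2 \<omega>)\<^sup>2) \<partial>M) - 1\<bar>
      + ereal (4 * prob_space.expectation M (\<lambda>\<omega>. \<bar>X 1 \<omega>\<bar> ^ 3) / root 4 (real n))"
proof -
  interpret prob_space M by fact
  note X = assms(3) and exch = assms(4) and i3 = assms(7)
  have sq: "expectation (\<lambda>\<omega>. (X i \<omega>)\<^sup>2) = 1" if "i \<in> {1..n}" for i
    using assms(5,6)[OF that] by simp
  have 1: "1 \<in> {1..n}" using assms(2) by simp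
  define m where "m = expectation (\<lambda>\<omega>. \<bar>X 1 \<omega>\<bar> ^ 3)"
  have m: "expectation (\<lambda>\<omega>. \<bar>X i \<omega>\<bar> ^ 3) = m" if i: "i \<in> {1..n}" for i
  proof -
    \<comment> \<open>Any partner index will do: the pair lemma is applied to a function that
      ignores its second argument.\<close>
    obtain j where j: "j \<in> {1..n}" "i \<noteq> j"
      using assms(2) by (intro that[of "if i = 1 then 2 else 1"]) auto
    have "(\<integral>\<^sup>+\<omega>. ennreal (\<bar>X i \<omega>\<bar> ^ 3) \<partial>M) = (\<integral>\<^sup>+\<omega>. ennreal (\<bar>X 1 \<omega>\<bar> ^ 3) \<partial>M)"
      using exchangeable_nn_integral_pair[OF exch X, of "\<lambda>x _. ennreal (\<bar>x\<bar> ^ 3)"] i j by simp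
    then show ?thesis
      using i3[OF i] i3[OF 1] by (simp add: m_def integral_eq_nn_integral)
  qed
  have "m \<ge> 1"
  proof -
    \<comment> \<open>This is AM-GM for |x|^3, |x|^3, 1, with a double root at |x| = 1. Taking
      expectations gives 1 \<le> (2m + 1) / 3.\<close>
    have "x\<^sup>2 \<le> (2 * \<bar>x\<bar> ^ 3 + 1) / 3" for x :: real
    proof -
      have "0 \<le> (\<bar>x\<bar> - 1)\<^sup>2 * (2 * \<bar>x\<bar> + 1)" by simp
      also have "\<dots> = 2 * \<bar>x\<bar> ^ 3 + 1 - 3 * \<bar>x\<bar>\<^sup>2"
        by (simp only: power2_eq_square power3_eq_cube) (simp add: algebra_simps)
      finally show ?thesis by simp
    qed
    moreover have "integrable M (\<lambda>\<omega>. (X 1 \<omega>)\<^sup>2)"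
      using sq[OF 1] not_integrable_integral_eq by fastforce
    ultimately have "expectation (\<lambda>\<omega>. (X 1 \<omega>)\<^sup>2) \<le> expectation (\<lambda>\<omega>. (2 * \<bar>X 1 \<omega>\<bar> ^ 3 + 1) / 3)"
      using i3[OF 1] by (intro integral_mono) auto
    then show ?thesis
      using i3[OF 1] sq[OF 1] by (simp add: m_def prob_space)
  qed
  define r where "r = root 4 (real n)"
  have r: "r \<ge> 1" "real n = r ^ 4"
    using assms(2) by (auto simp: r_def)
  show ?thesis
  proof (cases "(\<integral>\<^sup>+\<omega>. ennreal ((X 1 \<omega>)\<^sup>2 * (X 2 \<omega>)\<^sup>2) \<partial>M)")
    case (real e)
    \<comment> \<open>The level \<open>r\<^sup>2\<close>, the square root of n, balances the error
      terms: \<open>T * m / n\<close> and \<open>m / T\<close> both become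
      \<open>m / r\<^sup>2\<close>.\<close>
    have "osc M n X \<le> sqrt (\<bar>e - 1\<bar> + r\<^sup>2 * m / n + 2 * m / r\<^sup>2) + m / r\<^sup>2"
    proof (rule osc_le_truncated)
      show "(\<integral>\<^sup>+\<omega>. ennreal ((X i \<omega>)\<^sup>2 * (X j \<omega>)\<^sup>2) \<partial>M) \<le> ennreal e"
        if "i \<in> {1..n}" "j \<in> {1..n}" "i \<noteq> j" for i j
        using exchangeable_nn_integral_pair[OF exch X _ that, of "\<lambda>x y. ennreal (x\<^sup>2 * y\<^sup>2)"] real
        by simp
    qed (use assms(2) X sq i3 m r real in auto)
    also have "r\<^sup>2 * m / n = m / r\<^sup>2"
      using r by (simp add: field_simps power2_eq_square power4_eq_xxxx)
    also have "sqrt (\<bar>e - 1\<bar> + m / r\<^sup>2 + 2 * m / r\<^sup>2) \<le> sqrt \<bar>e - 1\<bar> + sqrt (3 * m / r\<^sup>2)"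
      using sqrt_add_le_add_sqrt[of "\<bar>e - 1\<bar>" "3 * m / r\<^sup>2"] \<open>m \<ge> 1\<close>
      by (simp add: add_divide_distrib[symmetric] add.assoc)
    \<comment> \<open>Here m \<ge> 1 enters: 3m \<ge> 1 gives sqrt(3m) \<le> 3m. With the remaining
      \<open>m / r\<^sup>2\<close>, at most \<open>m / r\<close>, this makes the constant 3 + 1 =
      4.\<close>
    also have "sqrt (3 * m / r\<^sup>2) \<le> 3 * m / r"
    proof (rule real_le_lsqrt)
      show "3 * m / r\<^sup>2 \<le> (3 * m / r)\<^sup>2"
        using \<open>m \<ge> 1\<close> r by (simp add: power_divide divide_right_mono power2_eq_square)
    qed (use \<open>m \<ge> 1\<close> r in auto)
    also have "m / r\<^sup>2 \<le> m / r"
      using \<open>m \<ge> 1\<close> r by (intro divide_left_mono) (auto simp: power2_eq_square)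
    finally have "osc M n X \<le> sqrt \<bar>e - 1\<bar> + 4 * m / r"
      by (simp add: add_divide_distrib[symmetric])
    then show ?thesis
      using real by (simp add: m_def r_def one_ereal_def)
  next
    case top
    \<comment> \<open>An infinite product moment makes the right side infinite. The defining
      equation is stated for \<open>PInfty\<close>, hence the unfolding.\<close>
    have "ereal_sqrt \<infinity> = \<infinity>" unfolding infinity_ereal_def by (rule ereal_sqrt.simps(2))
    with top show ?thesis by (simp add: one_ereal_def)
  qed
qed

end
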